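(* For the CorrKO instance $\mathcal I_H$ described in the context (for any integer $H\ge4$), there is an adaptive policy whose expected reward is at least an absolute constant $c>0$ independent of $H$ (i.e., $\Omega(1)$).
   Context: CorrKO: a finite metric $(V,d)$, root $\rho$, travel budget $B$, processing budget $W$; each vertex $v$ has random size $S_v$ and correlated random reward $R_v$, independent across vertices; a policy starts at $\rho$ and visits distinct vertices, processing each job non-preemptively with $(S_v,R_v)$ revealed on completion; if it visits $\rho=v_0,\dots,v_\ell$ then $\sum_{i=1}^\ell d(v_{i-1},v_i)\le B$ and $\sum_{i=1}^{\ell-1}S_{v_i}\le W$, and the reward of $v_i$ is collected iff $\sum_{h\le i}S_{v_h}\le W$; an adaptive policy may choose the next vertex based on observed realizations. The instance $\mathcal I_H$: let $T$ be a complete binary tree with $H$ levels, root $r$ at level $H$, leaves at level $1$; $\mathrm{lev}(v)$ is the level of $v$; the edge between a non-leaf $v$ at level $\ell$ and each of its children has length $2^{\ell-2}$; the metric is the induced tree metric on the nodes of $T$ plus a dummy root $\rho$ at distance $0$ from $r$ (with size and reward $0$). $W=2^{2^{H+1}}$, $B=2^{H-1}-1$. For $v\in T$, $\mathrm{path}(v)$ is the $r$-$v$ path in $T$, and $\mathrm{rt}(\mathrm{path}(v))$ is the set of nodes $w\ne v$ on $\mathrm{path}(v)$ whose successor on $\mathrm{path}(v)$ is the right child of $w$. Define $S^{(2)}_v=2^{2^{\mathrm{lev}(v)}}\prod_{w\in\mathrm{rt}(\mathrm{path}(v))}2^{2^{\mathrm{lev}(w)}}$, $S^{(1)}_v=W-\sum_{w\in\mathrm{rt}(\mathrm{path}(v))}S^{(2)}_w$,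 and $R^{(1)}_v=(1-1/\sqrt H)^{|\mathrm{rt}(\mathrm{path}(v))|}$. Then $(S_v,R_v)$ equals $(0,0)$ with probability $1-\frac1{\sqrt H}-\frac1H$, $(S^{(2)}_v,0)$ with probability $\frac1{\sqrt H}$, and $(S^{(1)}_v,R^{(1)}_v)$ with probability $\frac1H$. *)

theory Defs
  imports "HOL-Probability.Probability" "HOL-Library.Sublist"
begin

section \<open>Correlated knapsack orienteering\<close>

record 'v corrko =
  verts :: "'v set"
  start :: 'v
  metric :: "'v \<Rightarrow> 'v \<Rightarrow> real"
  travel_budget :: real
  proc_budget :: real
  job :: "'v \<Rightarrow> (real \<times> real) pmf"  \<comment> \<open>joint law of the pair (size, reward) of a vertex\<close>

text \<open>The metric may vanish on distinct vertices (co-located vertices), as happens for the dummy root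
  of the instance below.\<close>

definition corrko_instance :: "'v corrko \<Rightarrow> bool" where
  "corrko_instance I \<longleftrightarrow>
     finite (verts I) \<and> start I \<in> verts I \<and>
     (\<forall>u\<in>verts I. metric I u u = 0) \<and>
     (\<forall>u\<in>verts I. \<forall>v\<in>verts I. 0 \<le> metric I u v \<and> metric I u v = metric I v u) \<and>
     (\<forall>u\<in>verts I. \<forall>v\<in>verts I. \<forall>w\<in>verts I. metric I u w \<le> metric I u v + metric I v w) \<and>
     0 \<le> travel_budget I \<and> 0 \<le> proc_budget I \<and>
     (\<forall>v\<in>verts I. \<forall>(s, x) \<in> set_pmf (job I v). 0 \<le> s \<and> 0 \<le> x) \<and>
     job I (start I) = return_pmf (0, 0)"

text \<open>A realization assigns (size, reward) to every vertex; the vertices are independent, which is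
  what the product distribution expresses.\<close>

definition realizations :: "'v corrko \<Rightarrow> ('v \<Rightarrow> real \<times> real) pmf" where
  "realizations I = Pi_pmf (verts I) (0, 0) (job I)"

text \<open>A history lists the vertices visited after the root, in order, each with its observed size and
  reward. An adaptive policy maps the history to the next vertex, or stops (\<^term>\<open>None\<close>).\<close>

type_synonym 'v history = "('v \<times> real \<times> real) list"
type_synonym 'v policy = "'v history \<Rightarrow> 'v option"

primrec run :: "'v policy \<Rightarrow> ('v \<Rightarrow> real \<times> real) \<Rightarrow> nat \<Rightarrow> 'v history" where
  "run \<pi> \<omega> 0 = []"
| "run \<pi> \<omega> (Suc n) =
     (case \<pi> (run \<pi> \<omega> n) of
        None \<Rightarrow> run \<pi> \<omega> n
      | Some v \<Rightarrow> run \<pi> \<omega> n @ [(v, \<omega> v)])"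

text \<open>A policy that visits distinct vertices other than the root stops within fewer than
  \<open>card (verts I)\<close> steps, so this is its complete run. Conversely, a run that is still going after
  that many steps violates the distinctness requirement of \<open>feasible_history\<close>.\<close>

definition trajectory :: "'v corrko \<Rightarrow> 'v policy \<Rightarrow> ('v \<Rightarrow> real \<times> real) \<Rightarrow> 'v history" where
  "trajectory I \<pi> \<omega> = run \<pi> \<omega> (card (verts I))"

definition visited :: "'v history \<Rightarrow> 'v list" where
  "visited h = map fst h"

definition sizes :: "'v history \<Rightarrow> real list" where
  "sizes h = map (\<lambda>(v, s, x). s) h"

definition rewards :: "'v history \<Rightarrow> real list" where
  "rewards h = map (\<lambda>(v, s, x). x) h"

definition travel :: "'v corrko \<Rightarrow> 'v history \<Rightarrow> real" where
  "travel I h = (\<Sum>i<length h. metric I ((start I # visited h) ! i) (visited h ! i))"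

text \<open>The size of the last vertex visited does not count: its job may overrun the budget
  (it then earns nothing, see \<open>collected\<close>).\<close>

definition feasible_history :: "'v corrko \<Rightarrow> 'v history \<Rightarrow> bool" where
  "feasible_history I h \<longleftrightarrow>
     set (visited h) \<subseteq> verts I \<and> distinct (start I # visited h) \<and>
     travel I h \<le> travel_budget I \<and>
     sum_list (butlast (sizes h)) \<le> proc_budget I"

definition adaptive_policy :: "'v corrko \<Rightarrow> 'v policy \<Rightarrow> bool" where
  "adaptive_policy I \<pi> \<longleftrightarrow>
     (\<forall>\<omega>\<in>set_pmf (realizations I). feasible_history I (trajectory I \<pi> \<omega>))"

definition collected :: "'v corrko \<Rightarrow> 'v history \<Rightarrow> real" where
  "collected I h =
     (\<Sum>i<length h. if sum_list (take (Suc i) (sizes h)) \<le> proc_budget I then rewards h ! i else 0)"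

definition expected_reward :: "'v corrko \<Rightarrow> 'v policy \<Rightarrow> real" where
  "expected_reward I \<pi> =
     measure_pmf.expectation (realizations I) (\<lambda>\<omega>. collected I (trajectory I \<pi> \<omega>))"


section \<open>The binary tree instance\<close>

text \<open>A tree node is the sequence of turns leading to it from the tree root \<open>[]\<close>: \<^term>\<open>True\<close> is a step
  to the right child, \<^term>\<open>False\<close> to the left. The nodes of the tree with \<open>H\<close> levels are the sequences
  of length less than \<open>H\<close>.\<close>

type_synonym node = "bool list"

datatype vertex = Dummy | Node node

definition tree_nodes :: "nat \<Rightarrow> node set" where
  "tree_nodes H = {p. length p < H}"

definition tree_verts :: "nat \<Rightarrow> vertex set" where
  "tree_verts H = insert Dummy (Node ` tree_nodes H)"

definition lev :: "nat \<Rightarrow> node \<Rightarrow> nat" where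
  "lev H p = H - length p"

inductive tree_edge :: "nat \<Rightarrow> vertex \<Rightarrow> vertex \<Rightarrow> real \<Rightarrow> bool" for H where
  dummy: "tree_edge H Dummy (Node []) 0"
| child: "p @ [b] \<in> tree_nodes H \<Longrightarrow> tree_edge H (Node p) (Node (p @ [b])) (2 ^ (lev H p - 2))"
| sym: "tree_edge H u v x \<Longrightarrow> tree_edge H v u x"

inductive tree_walk :: "nat \<Rightarrow> vertex \<Rightarrow> vertex \<Rightarrow> real \<Rightarrow> bool" for H where
  refl: "tree_walk H u u 0"
| step: "tree_edge H u v x \<Longrightarrow> tree_walk H v w y \<Longrightarrow> tree_walk H u w (x + y)"

definition tree_metric :: "nat \<Rightarrow> vertex \<Rightarrow> vertex \<Rightarrow> real" where
  "tree_metric H u v = Inf {x. tree_walk H u v x}"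

definition proc_W :: "nat \<Rightarrow> real" where
  "proc_W H = 2 ^ (2 ^ (H + 1))"

definition travel_B :: "nat \<Rightarrow> real" where
  "travel_B H = 2 ^ (H - 1) - 1"

text \<open>The path from the tree root to \<open>p\<close> consists of the prefixes of \<open>p\<close>.\<close>

definition rt :: "node \<Rightarrow> node set" where
  "rt p = {w. prefix (w @ [True]) p}"

definition size2 :: "nat \<Rightarrow> node \<Rightarrow> real" where
  "size2 H p = 2 ^ (2 ^ lev H p) * (\<Prod>w\<in>rt p. 2 ^ (2 ^ lev H w))"

definition size1 :: "nat \<Rightarrow> node \<Rightarrow> real" where
  "size1 H p = proc_W H - (\<Sum>w\<in>rt p. size2 H w)"

definition reward1 :: "nat \<Rightarrow> node \<Rightarrow> real" where
  "reward1 H p = (1 - 1 / sqrt (real H)) ^ card (rt p)"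

definition node_outcomes :: "nat \<Rightarrow> node \<Rightarrow> ((real \<times> real) \<times> real) list" where
  "node_outcomes H p =
     [((0, 0), 1 - 1 / sqrt (real H) - 1 / real H),
      ((size2 H p, 0), 1 / sqrt (real H)),
      ((size1 H p, reward1 H p), 1 / real H)]"

fun tree_job :: "nat \<Rightarrow> vertex \<Rightarrow> (real \<times> real) pmf" where
  "tree_job H Dummy = return_pmf (0, 0)"
| "tree_job H (Node p) = pmf_of_list (node_outcomes H p)"

definition tree_instance :: "nat \<Rightarrow> vertex corrko" where
  "tree_instance H =
     \<lparr>verts = tree_verts H, start = Dummy, metric = tree_metric H,
      travel_budget = travel_B H, proc_budget = proc_W H, job = tree_job H\<rparr>"


section \<open>The tree instance is well-formed\<close>

text \<open>\<^const>\<open>pmf_of_list\<close> is unspecified unless the weights are nonnegative and sum to 1; for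
  \<open>H \<ge> 4\<close> they do.\<close>

lemma node_outcomes_wf:
  assumes "H \<ge> 4"
  shows "pmf_of_list_wf (node_outcomes H p)"
proof -
  have "sqrt (real H) \<ge> sqrt 4"
    using assms by (subst real_sqrt_le_iff) simp
  then have "1 / sqrt (real H) \<le> 1 / 2"
    using assms by (intro divide_left_mono) auto
  moreover have "1 / real H \<le> 1 / 4"
    using assms by (intro divide_left_mono) auto
  ultimately show ?thesis
    by (simp add: pmf_of_list_wf_def node_outcomes_def)
qed

lemma finite_tree_verts: "finite (tree_verts H)"
proof -
  have "tree_nodes H \<subseteq> {p. set p \<subseteq> UNIV \<and> length p \<le> H}"
    by (auto simp: tree_nodes_def)
  then have "finite (tree_nodes H)"
    by (rule finite_subset) (rule finite_lists_length_le, rule finite)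
  then show ?thesis
    by (simp add: tree_verts_def)
qed

lemma tree_edge_nonneg: "tree_edge H u v x \<Longrightarrow> 0 \<le> x"
  by (induction rule: tree_edge.induct) auto

lemma tree_walk_nonneg: "tree_walk H u v x \<Longrightarrow> 0 \<le> x"
  by (induction rule: tree_walk.induct) (auto dest: tree_edge_nonneg)

lemma tree_walk_append:
  "tree_walk H u v x \<Longrightarrow> tree_walk H v w y \<Longrightarrow> tree_walk H u w (x + y)"
proof (induction rule: tree_walk.induct)
  case (step u v x w' y')
  then show ?case
    using tree_walk.step[of H u v x w "y' + y"] by (simp add: add.assoc)
qed simp

lemma tree_walk_edge: "tree_edge H u v x \<Longrightarrow> tree_walk H u v x"
  using tree_walk.step[OF _ tree_walk.refl, of H u v x] by simp

lemma tree_walk_sym: "tree_walk H u v x \<Longrightarrow> tree_walk H v u x"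
proof (induction rule: tree_walk.induct)
  case (step u v x w y)
  have "tree_walk H v u x"
    using tree_walk_edge[OF tree_edge.sym[OF step.hyps(1)]] .
  from tree_walk_append[OF step.IH this] show ?case
    by (simp add: add.commute)
qed (rule tree_walk.refl)

lemma tree_walk_from_dummy:
  assumes "v \<in> tree_verts H"
  shows "\<exists>x. tree_walk H Dummy v x"
proof -
  have "length p < H \<Longrightarrow> \<exists>x. tree_walk H Dummy (Node p) x" for p
  proof (induction p rule: rev_induct)
    case Nil
    then show ?case
      using tree_walk_edge[OF tree_edge.dummy, of H] by blast
  next
    case (snoc b p)
    then obtain x where x: "tree_walk H Dummy (Node p) x"
      by auto
    have "tree_walk H (Node p) (Node (p @ [b])) (2 ^ (lev H p - 2))"
      using snoc.prems by (intro tree_walk_edge tree_edge.child) (simp add: tree_nodes_def)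
    from tree_walk_append[OF x this] show ?case ..
  qed
  then show ?thesis
    using assms tree_walk.refl[of H Dummy] by (auto simp: tree_verts_def tree_nodes_def)
qed

lemma tree_walk_ex:
  assumes "u \<in> tree_verts H" "v \<in> tree_verts H"
  shows "{x. tree_walk H u v x} \<noteq> {}"
proof -
  obtain x where x: "tree_walk H Dummy u x"
    using tree_walk_from_dummy[OF assms(1)] by blast
  obtain y where y: "tree_walk H Dummy v y"
    using tree_walk_from_dummy[OF assms(2)] by blast
  show ?thesis
    using tree_walk_append[OF tree_walk_sym[OF x] y] by blast
qed

lemma tree_walk_bdd: "bdd_below {x. tree_walk H u v x}"
  by (rule bdd_belowI[of _ 0]) (simp add: tree_walk_nonneg)

lemma tree_metric_le: "tree_walk H u v x \<Longrightarrow> tree_metric H u v \<le> x"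
  unfolding tree_metric_def by (rule cInf_lower) (auto intro: tree_walk_bdd)

lemma tree_metric_nonneg:
  assumes "u \<in> tree_verts H" "v \<in> tree_verts H"
  shows "0 \<le> tree_metric H u v"
  unfolding tree_metric_def
  by (rule cInf_greatest[OF tree_walk_ex[OF assms]]) (simp add: tree_walk_nonneg)

lemma tree_metric_refl:
  assumes "u \<in> tree_verts H"
  shows "tree_metric H u u = 0"
  using tree_metric_nonneg[OF assms assms] tree_metric_le[OF tree_walk.refl, of H u] by simp

lemma tree_metric_sym: "tree_metric H u v = tree_metric H v u"
proof -
  have "{x. tree_walk H u v x} = {x. tree_walk H v u x}"
    by (rule Collect_cong) (rule iffI; erule tree_walk_sym)
  then show ?thesis
    unfolding tree_metric_def by (rule arg_cong)
qed

lemma tree_metric_triangle: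
  assumes "u \<in> tree_verts H" "v \<in> tree_verts H" "w \<in> tree_verts H"
  shows "tree_metric H u w \<le> tree_metric H u v + tree_metric H v w"
proof -
  have *: "tree_metric H u w - y \<le> tree_metric H u v" if "tree_walk H v w y" for y
    unfolding tree_metric_def[of H u v]
  proof (rule cInf_greatest[OF tree_walk_ex[OF assms(1,2)]])
    fix x assume "x \<in> {x. tree_walk H u v x}"
    then show "tree_metric H u w - y \<le> x"
      using tree_metric_le[OF tree_walk_append[OF _ that], of u x] by simp
  qed
  have "tree_metric H u w - tree_metric H u v \<le> tree_metric H v w"
    unfolding tree_metric_def[of H v w]
  proof (rule cInf_greatest[OF tree_walk_ex[OF assms(2,3)]])
    fix y assume "y \<in> {x. tree_walk H v w x}"
    then show "tree_metric H u w - tree_metric H u v \<le> y"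
      using *[of y] by simp
  qed
  then show ?thesis by simp
qed

lemma tree_metric_dummy:
  assumes "H \<ge> 1"
  shows "tree_metric H Dummy (Node []) = 0"
proof (rule antisym)
  show "tree_metric H Dummy (Node []) \<le> 0"
    by (intro tree_metric_le tree_walk_edge tree_edge.dummy)
  show "0 \<le> tree_metric H Dummy (Node [])"
    using assms by (intro tree_metric_nonneg) (auto simp: tree_verts_def tree_nodes_def)
qed

lemma tree_metric_child:
  assumes "p @ [b] \<in> tree_nodes H"
  shows "tree_metric H (Node p) (Node (p @ [b])) = 2 ^ (lev H p - 2)"
proof (rule antisym)
  let ?l = "2 ^ (lev H p - 2) :: real"
  have "tree_walk H (Node p) (Node (p @ [b])) ?l"
    using assms by (intro tree_walk_edge tree_edge.child)
  then show "tree_metric H (Node p) (Node (p @ [b])) \<le> ?l"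
    by (rule tree_metric_le)
  define f where "f v = (case v of Dummy \<Rightarrow> 0 | Node q \<Rightarrow> if prefix (p @ [b]) q then ?l else 0)" for v
  have edge: "\<bar>f v - f u\<bar> \<le> x" if "tree_edge H u v x" for u v x
    using that by (induction rule: tree_edge.induct) (auto simp: f_def)
  have walk: "f v - f u \<le> x" if "tree_walk H u v x" for u v x
    using that
  proof (induction rule: tree_walk.induct)
    case (step u v x w y)
    then show ?case
      using edge[OF step.hyps(1)] by linarith
  qed simp
  have nonempty: "{x. tree_walk H (Node p) (Node (p @ [b])) x} \<noteq> {}"
    using assms by (intro tree_walk_ex) (auto simp: tree_verts_def tree_nodes_def)
  have "f (Node (p @ [b])) - f (Node p) = ?l"
    by (auto simp: f_def prefix_def)
  then show "?l \<le> tree_metric H (Node p) (Node (p @ [b]))"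
    unfolding tree_metric_def by (intro cInf_greatest[OF nonempty]) (metis walk mem_Collect_eq)
qed

lemma rt_Nil: "rt [] = {}"
  by (auto simp: rt_def)

lemma rt_snoc: "rt (p @ [b]) = (if b then insert p (rt p) else rt p)"
  by (auto simp: rt_def)

lemma finite_rt: "finite (rt p)"
  by (induction p rule: rev_induct) (auto simp: rt_Nil rt_snoc)

lemma self_notin_rt: "p \<notin> rt p"
  by (auto simp: rt_def dest: prefix_length_le)

lemma prod_rt_bound:
  assumes "length p \<le> H"
  shows "(\<Prod>w\<in>rt p. 2 ^ (2 ^ lev H w)) * (2 :: real) ^ (2 * 2 ^ lev H p) \<le> proc_W H"
  using assms
proof (induction p rule: rev_induct)
  case Nil
  then show ?case
    by (simp add: rt_Nil proc_W_def lev_def)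
next
  case (snoc b p)
  let ?P = "(\<Prod>w\<in>rt p. 2 ^ (2 ^ lev H w)) :: real"
  have "lev H p = Suc (lev H (p @ [b]))"
    using snoc.prems by (simp add: lev_def)
  then have eq: "2 * 2 ^ lev H (p @ [b]) = (2 :: nat) ^ lev H p"
    by simp
  have P: "0 \<le> ?P"
    by (intro prod_nonneg) simp
  have IH: "?P * 2 ^ (2 * 2 ^ lev H p) \<le> proc_W H"
    using snoc by simp
  have two: "(2 :: real) ^ (2 * 2 ^ lev H p) = 2 ^ 2 ^ lev H p * 2 ^ 2 ^ lev H p"
    by (simp add: mult_2 power_add)
  show ?case
  proof (cases b)
    case True
    then show ?thesis
      unfolding eq rt_snoc using IH
      by (simp add: finite_rt self_notin_rt two mult_ac)
  next
    case False
    have "?P * 2 ^ 2 ^ lev H p \<le> ?P * (2 ^ 2 ^ lev H p * 2 ^ 2 ^ lev H p)"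
      using P by (intro mult_left_mono) auto
    also have "\<dots> \<le> proc_W H"
      using IH unfolding two .
    finally show ?thesis
      unfolding eq rt_snoc using False by simp
  qed
qed

lemma sum_size2_bound:
  "(\<Sum>w\<in>rt p. size2 H w) \<le> 2 * (\<Prod>w\<in>rt p. 2 ^ (2 ^ lev H w))"
proof (induction p rule: rev_induct)
  case Nil
  then show ?case
    by (simp add: rt_Nil)
next
  case (snoc b p)
  let ?P = "(\<Prod>w\<in>rt p. 2 ^ (2 ^ lev H w)) :: real"
  show ?case
  proof (cases b)
    case True
    have P: "0 \<le> ?P"
      by (intro prod_nonneg) simp
    have "(2 :: real) ^ 1 \<le> 2 ^ 2 ^ lev H p"
      by (intro power_increasing) auto
    then have "2 * ?P \<le> 2 ^ 2 ^ lev H p * ?P"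
      using P by (intro mult_right_mono) auto
    then show ?thesis
      using True snoc by (simp add: rt_snoc finite_rt self_notin_rt size2_def)
  qed (use snoc in \<open>simp add: rt_snoc\<close>)
qed

lemma size2_nonneg: "0 \<le> size2 H p"
  unfolding size2_def by (intro mult_nonneg_nonneg prod_nonneg) auto

lemma size1_nonneg:
  assumes "p \<in> tree_nodes H"
  shows "0 \<le> size1 H p"
proof -
  let ?P = "(\<Prod>w\<in>rt p. 2 ^ (2 ^ lev H w)) :: real"
  have P: "0 \<le> ?P"
    by (intro prod_nonneg) simp
  have "(1 :: nat) \<le> 2 * 2 ^ lev H p"
    by (metis le_add1 mult_2 one_le_power one_le_numeral order_trans)
  then have "(2 :: real) ^ 1 \<le> 2 ^ (2 * 2 ^ lev H p)"
    by (intro power_increasing) auto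
  then have "?P * 2 \<le> ?P * 2 ^ (2 * 2 ^ lev H p)"
    using P by (intro mult_left_mono) auto
  then show ?thesis
    using sum_size2_bound[of H p] prod_rt_bound[of p H] assms
    by (simp add: size1_def tree_nodes_def)
qed

lemma reward1_nonneg:
  assumes "H \<ge> 4"
  shows "0 \<le> reward1 H p"
  using assms unfolding reward1_def by (intro zero_le_power) simp

lemma tree_instance_wf:
  assumes "H \<ge> 4"
  shows "corrko_instance (tree_instance H)"
proof -
  have "0 \<le> s \<and> 0 \<le> x" if v: "v \<in> tree_verts H" and sx: "(s, x) \<in> set_pmf (tree_job H v)" for v s x
  proof (cases v)
    case Dummy
    then show ?thesis
      using sx by simp
  next
    case (Node p)
    then have "p \<in> tree_nodes H"
      using v by (auto simp: tree_verts_def)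
    moreover have "(s, x) \<in> set (map fst (node_outcomes H p))"
      using sx Node set_pmf_of_list[OF node_outcomes_wf[OF assms], of p] by auto
    ultimately show ?thesis
      using size1_nonneg size2_nonneg reward1_nonneg[OF assms]
      by (auto simp: node_outcomes_def)
  qed
  moreover have "0 \<le> travel_B H" "0 \<le> proc_W H" "Dummy \<in> tree_verts H"
    by (simp_all add: travel_B_def proc_W_def tree_verts_def)
  moreover have "tree_metric H u v = tree_metric H v u" for u v
    by (rule tree_metric_sym)
  ultimately show ?thesis
    by (auto simp: corrko_instance_def tree_instance_def finite_tree_verts tree_metric_refl
        tree_metric_nonneg tree_metric_triangle)
qed

end

theory Submission
  imports Defs
begin

text \<open>The policy reads each outcome as a direction: outcome \<open>(0, 0)\<close> sends it to the left child, the
  outcome of size \<^const>\<open>size2\<close> to the right child, and it stops as soon as a reward appears. Hence the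
  budget used up on reaching \<open>p\<close> is exactly \<open>\<Sum>w\<in>rt p. size2 H w\<close>, so that a job of size \<open>size1 H p\<close>
  fills the knapsack exactly and its reward is always collected. The discounts make the expected
  reward of a descent of \<open>k\<close> levels from \<open>p\<close> proportional to \<open>reward1 H p\<close>, with a factor \<open>U k\<close> obeying
  \<open>U (k + 1) = 1 / H + (1 - 2 / H) * U k\<close>. So \<open>U H = (1 - (1 - 2 / H) ^ H) / 2\<close>, which is at least
  \<open>1 / 3\<close> by Bernoulli's inequality.\<close>

text \<open>For \<open>H \<ge> 4\<close>, positivity of \<open>size2\<close> and
  \<open>reward1\<close> lets the tests \<open>x = 0\<close> and \<open>s \<noteq> 0\<close> tell
  the three outcomes apart.\<close>

definition descent_policy :: "nat \<Rightarrow> vertex policy" where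
  "descent_policy H h =
     (if h = [] then Some (Node [])
      else case last h of
        (Node p, s, x) \<Rightarrow> if x = 0 \<and> Suc (length p) < H then Some (Node (p @ [s \<noteq> 0])) else None
      | (Dummy, s, x) \<Rightarrow> None)"

text \<open>What the policy earns from \<open>p\<close> on with \<open>k\<close> levels left,
  expressed without histories or budgets. The recursion follows the subtrees, so its expectation can
  be found by induction on \<open>k\<close>.\<close>

primrec descent_reward :: "(vertex \<Rightarrow> real \<times> real) \<Rightarrow> node \<Rightarrow> nat \<Rightarrow> real" where
  "descent_reward \<omega> p 0 = 0"
| "descent_reward \<omega> p (Suc k) =
     (if snd (\<omega> (Node p)) = 0 then descent_reward \<omega> (p @ [fst (\<omega> (Node p)) \<noteq> 0]) k
      else snd (\<omega> (Node p)))"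

text \<open>A rewardless history together with the node due next. That node is not in the history
  yet; at length \<open>H\<close> it lies below a leaf, outside the tree.\<close>

inductive descent :: "nat \<Rightarrow> vertex history \<Rightarrow> node \<Rightarrow> bool" for H where
  Nil: "descent H [] []"
| left: "descent H h p \<Longrightarrow> descent H (h @ [(Node p, 0, 0)]) (p @ [False])"
| right: "descent H h p \<Longrightarrow> descent H (h @ [(Node p, size2 H p, 0)]) (p @ [True])"

lemma size2_pos: "0 < size2 H p"
  unfolding size2_def by (intro mult_pos_pos prod_pos) auto

lemma reward1_pos:
  assumes "H \<ge> 4"
  shows "0 < reward1 H p"
proof -
  have "1 < sqrt (real H)"
    using assms by simp
  then show ?thesis
    unfolding reward1_def by simp
qed

lemma reward1_snoc:
  "reward1 H (p @ [b]) = reward1 H p * (if b then 1 - 1 / sqrt (real H) else 1)"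
  by (simp add: reward1_def rt_snoc finite_rt self_notin_rt)

section \<open>Travel, processing and reward along a descent\<close>

lemma travel_snoc:
  "travel I (h @ [(v, y)]) = travel I h + metric I (last (start I # visited h)) v"
proof -
  have last: "last (start I # visited h) = (start I # visited h) ! length h"
    by (simp add: last_conv_nth visited_def)
  have "metric I ((start I # visited (h @ [(v, y)])) ! i) (visited (h @ [(v, y)]) ! i) =
      metric I ((start I # visited h) ! i) (visited h ! i)" if "i < length h" for i
    using that by (cases i) (auto simp: visited_def nth_append)
  moreover have "(start I # visited (h @ [(v, y)])) ! length h = (start I # visited h) ! length h"
    by (cases "length h") (auto simp: visited_def nth_append)
  ultimately show ?thesis
    unfolding last by (simp add: travel_def) (simp add: visited_def nth_append)
qed

lemma sizes_snoc: "sizes (h @ [(v, s, x)]) = sizes h @ [s]"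
  by (simp add: sizes_def)

lemma collected_snoc:
  "collected I (h @ [(v, s, x)]) =
     collected I h + (if sum_list (sizes h) + s \<le> proc_budget I then x else 0)"
  by (simp add: collected_def sizes_def rewards_def nth_append cong: if_cong)

lemma strict_prefixes_snoc: "{q. strict_prefix q (p @ [b])} = insert p {q. strict_prefix q p}"
  unfolding strict_prefix_def by (auto dest: prefix_length_le)

lemma descent_visited:
  "descent H h p \<Longrightarrow> distinct (visited h) \<and> set (visited h) = Node ` {q. strict_prefix q p}"
  by (induction rule: descent.induct) (auto simp: visited_def strict_prefixes_snoc)

lemma descent_sizes: "descent H h p \<Longrightarrow> sum_list (sizes h) = (\<Sum>w\<in>rt p. size2 H w)"
  by (induction rule: descent.induct)
    (auto simp: sizes_snoc rt_snoc rt_Nil finite_rt self_notin_rt sizes_def)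

lemma descent_collected: "descent H h p \<Longrightarrow> collected I h = 0"
  by (induction rule: descent.induct) (auto simp: collected_snoc, simp add: collected_def)

lemma travel_child:
  assumes "length (p @ [b]) < H"
    and "travel (tree_instance H) (h @ [(Node p, y)]) = 2 ^ (H - 1) - 2 ^ (H - 1 - length p)"
  shows "travel (tree_instance H) ((h @ [(Node p, y)]) @ [(Node (p @ [b]), z)]) =
    2 ^ (H - 1) - 2 ^ (H - 1 - length (p @ [b]))"
proof -
  \<comment> \<open>The exponents agree:
    \<open>lev H p - 2 = H - 1 - length (p @ [b])\<close>.\<close>
  have "tree_metric H (Node p) (Node (p @ [b])) = 2 ^ (H - 1 - length (p @ [b]))"
    using assms(1) by (subst tree_metric_child) (auto simp: tree_nodes_def lev_def numeral_2_eq_2)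
  moreover have "H - 1 - length p = Suc (H - 1 - length (p @ [b]))"
    using assms(1) by simp
  ultimately show ?thesis
    unfolding travel_snoc[of _ "h @ [(Node p, y)]"] assms(2)
    by (simp add: tree_instance_def visited_def)
qed

text \<open>The edge lengths halve at each level, so the geometric sum telescopes. A leaf has length
  \<open>H - 1\<close>, where the value is exactly \<open>travel_B H\<close>.\<close>

lemma descent_travel:
  assumes "descent H h p" "length p < H"
  shows "travel (tree_instance H) (h @ [(Node p, y)]) = 2 ^ (H - 1) - 2 ^ (H - 1 - length p)"
  using assms
proof (induction arbitrary: y rule: descent.induct)
  case Nil
  then show ?case
    using travel_snoc[of "tree_instance H" "[]"] tree_metric_dummy[of H]
    by (simp add: tree_instance_def travel_def visited_def)
qed (use travel_child in simp_all)

text \<open>The last outcome \<open>y\<close> may be anything since \<open>butlast\<close> drops its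
  size. The earlier sizes sum to \<open>proc_W H - size1 H p\<close>, so the processing bound
  amounts to \<open>size1_nonneg\<close>.\<close>

lemma descent_feasible:
  assumes "descent H h p" "length p < H"
  shows "feasible_history (tree_instance H) (h @ [(Node p, y)])"
proof -
  obtain s x where y: "y = (s, x)"
    by (cases y)
  have "set (visited (h @ [(Node p, y)])) \<subseteq> tree_verts H"
    using descent_visited[OF assms(1)] assms(2)
    by (auto simp: visited_def tree_verts_def tree_nodes_def dest: prefix_length_less)
  moreover have "distinct (Dummy # visited (h @ [(Node p, y)]))"
    using descent_visited[OF assms(1)] by (auto simp: visited_def)
  moreover have "travel (tree_instance H) (h @ [(Node p, y)]) \<le> travel_B H"
    unfolding descent_travel[OF assms] travel_B_def by simp
  moreover have "sum_list (butlast (sizes (h @ [(Node p, y)]))) \<le> proc_W H"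
    using size1_nonneg[of p H] assms(2)
    by (simp add: y sizes_snoc descent_sizes[OF assms(1)] size1_def tree_nodes_def)
  ultimately show ?thesis
    by (simp add: feasible_history_def tree_instance_def)
qed

section \<open>Expected reward of a descent\<close>

lemma set_pmf_tree_job:
  assumes "H \<ge> 4"
  shows "set_pmf (tree_job H (Node p)) \<subseteq> {(0, 0), (size2 H p, 0), (size1 H p, reward1 H p)}"
  using set_pmf_of_list[OF node_outcomes_wf[OF assms], of p] by (simp add: node_outcomes_def)

lemma expectation_tree_job:
  fixes f :: "real \<times> real \<Rightarrow> real"
  assumes "H \<ge> 4"
  shows "measure_pmf.expectation (tree_job H (Node p)) f =
    (1 - 1 / sqrt (real H) - 1 / real H) * f (0, 0) + 1 / sqrt (real H) * f (size2 H p, 0) +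
    1 / real H * f (size1 H p, reward1 H p)"
proof -
  have pmf: "pmf (tree_job H (Node p)) y =
      sum_list (map snd (filter (\<lambda>z. fst z = y) (node_outcomes H p)))" for y
    by (simp add: pmf_pmf_of_list[OF node_outcomes_wf[OF assms]])
  \<comment> \<open>This makes the three outcomes distinct, so each one carries exactly its own
    weight.\<close>
  have "size2 H p \<noteq> 0" "reward1 H p \<noteq> 0"
    using size2_pos[of H p] reward1_pos[OF assms, of p] by auto
  then show ?thesis
    using set_pmf_tree_job[OF assms, of p]
    by (subst integral_measure_pmf[of "{(0, 0), (size2 H p, 0), (size1 H p, reward1 H p)}"])
      (auto simp: pmf node_outcomes_def simp del: tree_job.simps)
qed

lemma finite_set_tree_job:
  assumes "H \<ge> 4"
  shows "finite (set_pmf (tree_job H v))"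
  using finite_subset[OF set_pmf_tree_job[OF assms]] by (cases v) auto

lemma finite_set_Pi_pmf:
  assumes "finite A" "\<And>x. x \<in> A \<Longrightarrow> finite (set_pmf (p x))"
  shows "finite (set_pmf (Pi_pmf A dflt p))"
  using assms by (simp add: set_Pi_pmf finite_PiE_dflt)

text \<open>Conditioning on one coordinate of the product. Finite supports reduce the outer integral
  to a sum and settle integrability for any real \<open>f\<close>.\<close>

lemma expectation_Pi_pmf_insert:
  fixes f :: "('a \<Rightarrow> 'b) \<Rightarrow> real"
  assumes "finite A" "x \<notin> A" "\<And>y. y \<in> insert x A \<Longrightarrow> finite (set_pmf (p y))"
  shows "measure_pmf.expectation (Pi_pmf (insert x A) dflt p) f =
    measure_pmf.expectation (p x) (\<lambda>y. measure_pmf.expectation (Pi_pmf A dflt p) (\<lambda>\<eta>. f (\<eta>(x := y))))"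
proof -
  have fin: "finite (set_pmf (p x))" "finite (set_pmf (Pi_pmf A dflt p))"
    using assms by (auto intro: finite_set_Pi_pmf)
  have "Pi_pmf (insert x A) dflt p =
      p x \<bind> (\<lambda>y. map_pmf (\<lambda>\<eta>. \<eta>(x := y)) (Pi_pmf A dflt p))"
    using assms by (simp add: Pi_pmf_insert' map_pmf_def)
  then show ?thesis
    using fin by (simp add: pmf_expectation_bind[OF fin(1)] integral_measure_pmf[OF fin(1)])
qed

text \<open>Only the top \<open>k\<close> levels of the subtree at \<open>p\<close> are read. In
  particular the rewards from the children of \<open>p\<close> do not depend on the outcome at
  \<open>p\<close>.\<close>

lemma descent_reward_cong:
  assumes "\<And>r. length r < k \<Longrightarrow> \<omega> (Node (p @ r)) = \<omega>' (Node (p @ r))"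
  shows "descent_reward \<omega> p k = descent_reward \<omega>' p k"
  using assms
proof (induction k arbitrary: p)
  case (Suc k)
  have "\<omega> (Node p) = \<omega>' (Node p)"
    using Suc.prems[of "[]"] by simp
  moreover have "descent_reward \<omega> (p @ [b]) k = descent_reward \<omega>' (p @ [b]) k" for b
    using Suc.prems[of "b # _"] by (intro Suc.IH) simp
  ultimately show ?case
    by simp
qed simp

text \<open>\<open>A\<close> is left general because conditioning on \<open>p\<close> leaves a
  product over \<open>A - {Node p}\<close>, which still contains the levels read below either
  child.\<close>

lemma expectation_descent_reward:
  assumes "H \<ge> 4" "finite A" "\<And>r. length r < k \<Longrightarrow> Node (p @ r) \<in> A"
  shows "measure_pmf.expectation (Pi_pmf A (0, 0) (tree_job H)) (\<lambda>\<eta>. descent_reward \<eta> p k) =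
    reward1 H p * ((1 - (1 - 2 / real H) ^ k) / 2)"
  using assms(2,3)
proof (induction k arbitrary: p A)
  case (Suc k)
  define A' where "A' = A - {Node p}"
  define U where "U = (1 - (1 - 2 / real H) ^ k) / 2"
  have A: "A = insert (Node p) A'" "finite A'" "Node p \<notin> A'"
    using Suc.prems(1) Suc.prems(2)[of "[]"] by (auto simp: A'_def)
  have eq: "descent_reward (\<eta>(Node p := y)) p (Suc k) =
      (if snd y = 0 then descent_reward \<eta> (p @ [fst y \<noteq> 0]) k else snd y)" for \<eta> y
    by (auto intro: descent_reward_cong)
  have IH: "measure_pmf.expectation (Pi_pmf A' (0, 0) (tree_job H))
      (\<lambda>\<eta>. descent_reward \<eta> (p @ [b]) k) = reward1 H (p @ [b]) * U" for b
    unfolding U_def using A Suc.prems(2)[of "b # _"] by (intro Suc.IH) (auto simp: A'_def)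
  have "measure_pmf.expectation (Pi_pmf A (0, 0) (tree_job H)) (\<lambda>\<eta>. descent_reward \<eta> p (Suc k)) =
      measure_pmf.expectation (tree_job H (Node p))
        (\<lambda>y. if snd y = 0 then reward1 H (p @ [fst y \<noteq> 0]) * U else snd y)"
    unfolding A(1) using A(2,3) assms(1)
    by (subst expectation_Pi_pmf_insert)
      (auto simp: eq IH finite_set_tree_job simp del: descent_reward.simps
        intro!: Bochner_Integration.integral_cong)
  also have "\<dots> = (1 - 1 / sqrt (real H) - 1 / real H) * (reward1 H p * U) +
      1 / sqrt (real H) * (reward1 H p * (1 - 1 / sqrt (real H)) * U) + 1 / real H * reward1 H p"
    using size2_pos[of H p] reward1_pos[OF assms(1), of p]
    by (subst expectation_tree_job[OF assms(1)]) (simp add: reward1_snoc)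
  \<comment> \<open>The discount on right turns makes the terms of order \<open>1 / sqrt H\<close>
    cancel, leaving only its square, a loss of \<open>1 / H\<close>.\<close>
  also have "\<dots> = reward1 H p * (1 / real H + (1 - 1 / real H - (1 / sqrt (real H)) ^ 2) * U)"
    by (simp add: algebra_simps power2_eq_square)
  also have "(1 / sqrt (real H)) ^ 2 = 1 / real H"
    by (simp add: power_divide)
  also have "1 / real H + (1 - 1 / real H - 1 / real H) * U = (1 - (1 - 2 / real H) ^ Suc k) / 2"
    by (simp add: U_def field_simps)
  finally show ?case .
qed simp

section \<open>Runs of the policy\<close>

lemma descent_policy_next:
  assumes "descent H h p" "length p < H"
  shows "descent_policy H h = Some (Node p)"
  using assms size2_pos by cases (auto simp: descent_policy_def less_imp_neq[symmetric])

lemma descent_policy_leaf: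
  assumes "descent H h p" "length p = H" "H \<ge> 1"
  shows "descent_policy H h = None"
  using assms by cases (auto simp: descent_policy_def)

text \<open>Invariant of the run: either no reward has appeared and the total equals what is still
  to come from \<open>p\<close>, or the run has ended with a reward. Once
  \<open>length p = H\<close>, the first case says the total is 0.\<close>

lemma run_descent_policy:
  assumes "H \<ge> 4" "\<omega> \<in> set_pmf (realizations (tree_instance H))"
  shows "(\<exists>p. descent H (run (descent_policy H) \<omega> n) p \<and> length p = min n H \<and>
             descent_reward \<omega> [] H = descent_reward \<omega> p (H - length p)) \<or>
    (\<exists>h p. run (descent_policy H) \<omega> n = h @ [(Node p, size1 H p, reward1 H p)] \<and>
             descent H h p \<and> length p < H \<and> descent_reward \<omega> [] H = reward1 H p)"
proof (induction n)
  case 0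
  show ?case
    by (auto intro: descent.Nil)
next
  case (Suc n)
  let ?h = "run (descent_policy H) \<omega> n"
  from Suc show ?case
  proof (elim disjE exE conjE)
    fix p
    assume h: "descent H ?h p" and len: "length p = min n H"
      and rew: "descent_reward \<omega> [] H = descent_reward \<omega> p (H - length p)"
    show ?thesis
    proof (cases "n < H")
      case True
      then have next_p: "descent_policy H ?h = Some (Node p)"
        using descent_policy_next[OF h] len by simp
      \<comment> \<open>Exposes a successor, so that \<open>descent_reward\<close> unfolds by one
        step.\<close>
      have k: "H - length p = Suc (H - length (p @ [b]))" for b
        using True len by simp
      have "Node p \<in> tree_verts H"
        using True len by (simp add: tree_verts_def tree_nodes_def)
      then have "\<omega> (Node p) \<in> set_pmf (tree_job H (Node p))"
        using assms(2) unfolding realizations_def tree_instance_def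
        by (auto simp: set_Pi_pmf finite_tree_verts PiE_dflt_def)
      then consider "\<omega> (Node p) = (0, 0)" | "\<omega> (Node p) = (size2 H p, 0)"
        | "\<omega> (Node p) = (size1 H p, reward1 H p)"
        using set_pmf_tree_job[OF assms(1), of p] by blast
      then show ?thesis
      proof cases
        case 1
        then show ?thesis
          using next_p descent.left[OF h] rew True len unfolding k[of False]
          by (intro disjI1 exI[of _ "p @ [False]"]) simp
      next
        case 2
        then show ?thesis
          using next_p descent.right[OF h] rew True len size2_pos[of H p] unfolding k[of True]
          by (intro disjI1 exI[of _ "p @ [True]"]) simp
      next
        case 3
        then show ?thesis
          using next_p h rew True len reward1_pos[OF assms(1), of p] unfolding k[of True]
          by (intro disjI2 exI[of _ ?h] exI[of _ p]) simp
      qed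
    next
      case False
      then have "descent_policy H ?h = None"
        using descent_policy_leaf[OF h] len assms(1) by simp
      then show ?thesis
        using h len rew False by (intro disjI1 exI[of _ p]) simp
    qed
  next
    fix h p
    assume h: "?h = h @ [(Node p, size1 H p, reward1 H p)]" "descent H h p" "length p < H"
      "descent_reward \<omega> [] H = reward1 H p"
    have "descent_policy H ?h = None"
      unfolding h(1) using reward1_pos[OF assms(1), of p] by (simp add: descent_policy_def)
    then show ?thesis
      using h by (intro disjI2 exI[of _ h] exI[of _ p]) simp
  qed
qed

text \<open>Ensures that the step bound in \<open>trajectory\<close> does not cut a descent short.
  The rightmost branch supplies \<open>H\<close> distinct vertices.\<close>

lemma card_tree_verts_ge: "H \<le> card (tree_verts H)"
proof -
  have "inj_on (\<lambda>i. Node (replicate i True)) {..<H}"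
    by (auto intro!: inj_onI simp: replicate_eq_replicate)
  moreover have "(\<lambda>i. Node (replicate i True)) ` {..<H} \<subseteq> tree_verts H"
    by (auto simp: tree_verts_def tree_nodes_def)
  ultimately show ?thesis
    using card_inj_on_le[OF _ _ finite_tree_verts] by fastforce
qed

lemma trajectory_descent_policy:
  assumes "H \<ge> 4" "\<omega> \<in> set_pmf (realizations (tree_instance H))"
  defines "h \<equiv> trajectory (tree_instance H) (descent_policy H) \<omega>"
  shows "feasible_history (tree_instance H) h"
    and "collected (tree_instance H) h = descent_reward \<omega> [] H"
proof -
  have h: "h = run (descent_policy H) \<omega> (card (tree_verts H))"
    by (simp add: h_def trajectory_def tree_instance_def)
  consider (leaf) p where "descent H h p" "length p = H" "descent_reward \<omega> [] H = 0"
    | (reward) h' p where "h = h' @ [(Node p, size1 H p, reward1 H p)]" "descent H h' p"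
        "length p < H" "descent_reward \<omega> [] H = reward1 H p"
    using run_descent_policy[OF assms(1,2), of "card (tree_verts H)"] card_tree_verts_ge[of H]
    unfolding h[symmetric] by auto
  then have "feasible_history (tree_instance H) h \<and>
      collected (tree_instance H) h = descent_reward \<omega> [] H"
  proof cases
    case leaf
    \<comment> \<open>Rule inversion splits off the leaf visited last, giving the form that
      \<open>descent_feasible\<close> expects.\<close>
    from leaf(1) have "feasible_history (tree_instance H) h"
      using leaf(2) assms(1) by cases (auto intro: descent_feasible)
    then show ?thesis
      using leaf by (simp add: descent_collected)
  next
    case reward
    then show ?thesis
      using descent_feasible[OF reward(2,3)]
      by (simp add: collected_snoc descent_collected descent_sizes[OF reward(2)] size1_def tree_instance_def)
  qed
  then show "feasible_history (tree_instance H) h"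
    and "collected (tree_instance H) h = descent_reward \<omega> [] H"
    by auto
qed

section \<open>A bound independent of the height\<close>

text \<open>Bernoulli bounds powers from below, so it is applied to the conjugate factor:
  \<open>(1 + 2 / n) ^ n \<ge> 3\<close>, while the product of both powers is
  \<open>(1 - 4 / n\<^sup>2) ^ n \<le> 1\<close>.\<close>

lemma power_one_minus_le_third:
  assumes "n \<ge> 2"
  shows "(1 - 2 / real n) ^ n \<le> 1 / 3"
proof -
  have "1 + real n * (2 / real n) \<le> (1 + 2 / real n) ^ n"
    by (rule Bernoulli_inequality) (rule order_trans[of _ 0], simp_all)
  then have "3 \<le> (1 + 2 / real n) ^ n"
    using assms by simp
  moreover have "0 \<le> (1 - 2 / real n) ^ n"
    using assms by simp
  ultimately have "(1 - 2 / real n) ^ n * 3 \<le> (1 - 2 / real n) ^ n * (1 + 2 / real n) ^ n"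
    by (rule mult_left_mono)
  also have "\<dots> = (1 - (2 / real n)\<^sup>2) ^ n"
    by (simp add: power_mult_distrib[symmetric] algebra_simps power2_eq_square)
  also have "\<dots> \<le> 1"
    using assms by (intro power_le_one) (auto simp: power_le_one)
  finally show ?thesis
    by simp
qed

theorem theorem3p1:
  shows "\<exists>c>0. \<forall>H\<ge>4. \<exists>\<pi>. adaptive_policy (tree_instance H) \<pi> \<and>
           expected_reward (tree_instance H) \<pi> \<ge> c"
proof (rule exI[of _ "1 / 3"], intro conjI allI impI exI)
  fix H :: nat
  assume H: "H \<ge> 4"
  let ?I = "tree_instance H"
  show "adaptive_policy ?I (descent_policy H)"
    using trajectory_descent_policy(1)[OF H] by (simp add: adaptive_policy_def)
  \<comment> \<open>Collected and recursive rewards are known to agree on the support only, hence an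
    almost-everywhere argument.\<close>
  have "expected_reward ?I (descent_policy H) =
      measure_pmf.expectation (realizations ?I) (\<lambda>\<omega>. descent_reward \<omega> [] H)"
    unfolding expected_reward_def
    by (rule integral_cong_AE) (auto simp: AE_measure_pmf_iff trajectory_descent_policy(2)[OF H])
  also have "\<dots> = reward1 H [] * ((1 - (1 - 2 / real H) ^ H) / 2)"
    using expectation_descent_reward[OF H finite_tree_verts, of H "[]"]
    by (simp add: realizations_def tree_instance_def tree_verts_def tree_nodes_def)
  also have "\<dots> = (1 - (1 - 2 / real H) ^ H) / 2"
    by (simp add: reward1_def rt_Nil)
  finally show "1 / 3 \<le> expected_reward ?I (descent_policy H)"
    using power_one_minus_le_third[of H] H by simp
qed simp

end
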